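(* Fix a positive integer $k_A$. For every integer $\Delta_A \geq k_A$ there exists a real constant $c(\Delta_A)$ such that, writing $\beta(k_B)$ for the smallest positive integer $\Delta_B$ such that $K_{\Delta_B,\Delta_A}$ is not $(k_A,k_B)$-choosable, we have $\beta(k_B) \sim c(\Delta_A)\, k_B^{k_A}$ as $k_B \to \infty$. Moreover, $c(\Delta_A) \sim \xi_m(k_A)/(\log \Delta_A)^{k_A-1}$ as $\Delta_A \to \infty$.
   Context: All graphs are finite and simple. For a bipartite graph $G$ with bipartition $V = A \sqcup B$ and positive integers $k_A, k_B$, $G$ is $(k_A,k_B)$-choosable if for every set of colors $C$ and every list assignment $L$ assigning to each vertex of $A$ a $k_A$-element subset of $C$ and to each vertex of $B$ a $k_B$-element subset of $C$, there is a map $c\colon V\to C$ with $c(v)\in L(v)$ for all $v$ and $c(v)\neq c(v')$ for every edge $vv'$. For the complete bipartite graph $K_{\Delta_B,\Delta_A}$ the part $A$ has $\Delta_B$ vertices and the part $B$ has $\Delta_A$ vertices. $\log$ is the natural logarithm, with the convention $(\log x)^0=1$. For positive integers $\Delta_A,\Delta_B,k_A,k_B$ let $\xi = \Delta_B(\log\Delta_A)^{k_A-1}/k_B^{k_A}$, and let $\xi_m(k_A)$ be the infimum of $\xi$ over all positive integers $\Delta_A,\Delta_B,k_B$ such that $K_{\Delta_B,\Delta_A}$ is not $(k_A,k_B)$-choosable. $f \sim g$ means $f/g \to 1$. *)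

theory Defs
  imports
    Complex_Main
    "HOL-Library.Ramsey"
    "HOL-Library.Landau_Symbols"
    "Graph_Theory.Graph_Theory"
begin

definition bipartition :: "'v pair_pre_digraph \<Rightarrow> 'v set \<Rightarrow> 'v set \<Rightarrow> bool" where
  "bipartition G A B \<longleftrightarrow>
     pair_graph G \<and> pverts G = A \<union> B \<and> A \<inter> B = {} \<and> parcs G \<subseteq> A \<times> B \<union> B \<times> A"

text \<open>
  \<open>G\<close> is meant to satisfy \<open>bipartition G A B\<close>. Colours are natural numbers: a definition cannot
  quantify over types, and since only finitely many colours occur in the lists of a finite graph,
  \<open>choosable_any_colours\<close> below recovers arbitrary colour types.
\<close>
definition choosable :: "'v pair_pre_digraph \<Rightarrow> 'v set \<Rightarrow> 'v set \<Rightarrow> nat \<Rightarrow> nat \<Rightarrow> bool" where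
  "choosable G A B kA kB \<longleftrightarrow>
     (\<forall>(C :: nat set) L.
        (\<forall>v\<in>A. L v \<in> nsets C kA) \<and> (\<forall>v\<in>B. L v \<in> nsets C kB) \<longrightarrow>
        (\<exists>c. (\<forall>v\<in>pverts G. c v \<in> L v) \<and> (\<forall>(v, v')\<in>parcs G. c v \<noteq> c v')))"

definition left_part :: "nat \<Rightarrow> (nat + nat) set" where
  "left_part m = Inl ` {..<m}"

definition right_part :: "nat \<Rightarrow> (nat + nat) set" where
  "right_part n = Inr ` {..<n}"

definition complete_bipartite :: "nat \<Rightarrow> nat \<Rightarrow> (nat + nat) pair_pre_digraph" where
  "complete_bipartite m n =
     \<lparr> pverts = left_part m \<union> right_part n,
       parcs = left_part m \<times> right_part n \<union> right_part n \<times> left_part m \<rparr>"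

text \<open>
  \<open>K_choosable DB DA kA kB\<close>: the part with lists of size \<open>kA\<close> has \<open>DB\<close> vertices, the part with
  lists of size \<open>kB\<close> has \<open>DA\<close> vertices.
\<close>
definition K_choosable :: "nat \<Rightarrow> nat \<Rightarrow> nat \<Rightarrow> nat \<Rightarrow> bool" where
  "K_choosable DB DA kA kB \<longleftrightarrow>
     choosable (complete_bipartite DB DA) (left_part DB) (right_part DA) kA kB"

text \<open>Here \<open>0 ^ 0 = 1\<close>, so the case \<open>kA = 1\<close>, \<open>DA = 1\<close> follows the convention \<open>(log x)^0 = 1\<close>.\<close>
definition xi :: "nat \<Rightarrow> nat \<Rightarrow> nat \<Rightarrow> nat \<Rightarrow> real" where
  "xi DA DB kA kB = real DB * ln (real DA) ^ (kA - 1) / real kB ^ kA"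

definition xi_m :: "nat \<Rightarrow> real" where
  "xi_m kA = Inf {xi DA DB kA kB | DA DB kB.
     DA > 0 \<and> DB > 0 \<and> kB > 0 \<and> \<not> K_choosable DB DA kA kB}"

text \<open>The minimum exists whenever \<open>kA \<le> DA\<close> and \<open>kB > 0\<close>, see \<open>beta_exists\<close>.\<close>
definition beta :: "nat \<Rightarrow> nat \<Rightarrow> nat \<Rightarrow> nat" where
  "beta kA DA kB = (LEAST DB. DB > 0 \<and> \<not> K_choosable DB DA kA kB)"

lemma bipartition_complete_bipartite:
  "bipartition (complete_bipartite m n) (left_part m) (right_part n)"
proof -
  have "K\<^bsub>m,n\<^esub> (with_proj (complete_bipartite m n))"
    unfolding complete_bipartite_digraph_pair_def
  proof (intro conjI exI)
    show "finite (pverts (complete_bipartite m n))"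
      by (simp add: complete_bipartite_def left_part_def right_part_def)
    show "pverts (complete_bipartite m n) = left_part m \<union> right_part n"
      "parcs (complete_bipartite m n) = left_part m \<times> right_part n \<union> right_part n \<times> left_part m"
      by (simp_all add: complete_bipartite_def)
    show "left_part m \<inter> right_part n = {}"
      by (auto simp: left_part_def right_part_def)
    show "card (left_part m) = m" "card (right_part n) = n"
      by (simp_all add: left_part_def right_part_def card_image)
  qed
  then have "pair_graph (complete_bipartite m n)"
    by (rule pair_graphI_complete_bipartite)
  then show ?thesis
    by (auto simp: bipartition_def complete_bipartite_def left_part_def right_part_def)
qed

lemma choosable_any_colours:
  fixes L :: "'v \<Rightarrow> 'c set"
  assumes G: "bipartition G A B" and ch: "choosable G A B kA kB"
    and A: "\<forall>v\<in>A. L v \<in> nsets C kA" and B: "\<forall>v\<in>B. L v \<in> nsets C kB"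
  shows "\<exists>c. (\<forall>v\<in>pverts G. c v \<in> L v) \<and> (\<forall>(v, v')\<in>parcs G. c v \<noteq> c v')"
proof -
  interpret pair_graph G using G by (simp add: bipartition_def)
  have V: "pverts G = A \<union> B" using G by (simp add: bipartition_def)
  define U where "U = (\<Union>v\<in>pverts G. L v)"
  have "finite U"
    using A B pair_finite_verts unfolding U_def V by (auto simp: nsets_def)
  then obtain f :: "'c \<Rightarrow> nat" where f: "inj_on f U"
    using finite_imp_inj_to_nat_seg by blast
  have sub: "L v \<subseteq> U" if "v \<in> A \<union> B" for v
    using that by (auto simp: U_def V)
  have img: "f ` L v \<in> nsets UNIV k" if "v \<in> A \<union> B" "L v \<in> nsets C k" for v k
    using that sub[OF that(1)] f
    by (auto simp: nsets_def card_image inj_on_subset)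
  have "\<exists>c. (\<forall>v\<in>pverts G. c v \<in> f ` L v) \<and> (\<forall>(v, v')\<in>parcs G. c v \<noteq> c v')"
    using ch[unfolded choosable_def, rule_format, of "\<lambda>v. f ` L v" UNIV] A B img
    by blast
  then obtain c where c: "\<forall>v\<in>pverts G. c v \<in> f ` L v" "\<forall>(v, v')\<in>parcs G. c v \<noteq> c v'"
    by blast
  define d where "d v = inv_into U f (c v)" for v
  have d: "d v \<in> L v \<and> f (d v) = c v" if v: "v \<in> pverts G" for v
  proof -
    obtain x where x: "x \<in> L v" "c v = f x" using c(1) v by blast
    moreover have "x \<in> U" using x v by (auto simp: U_def)
    ultimately show ?thesis using f by (simp add: d_def)
  qed
  have "d v \<noteq> d v'" if e: "(v, v') \<in> parcs G" for v v'
  proof -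
    have "v \<in> pverts G" "v' \<in> pverts G" using e by (auto dest: in_arcsD1 in_arcsD2)
    then have "f (d v) = c v" "f (d v') = c v'" using d by auto
    moreover have "c v \<noteq> c v'" using c(2) e by blast
    ultimately show ?thesis by metis
  qed
  then show ?thesis using d by blast
qed

lemma beta_exists:
  assumes "kA \<le> DA" "kB > 0"
  shows "\<exists>DB. DB > 0 \<and> \<not> K_choosable DB DA kA kB"
proof -
  define T where "T = PiE {..<kA} (\<lambda>_. {..<kB})"
  define DB where "DB = card T"
  have finT: "finite T" unfolding T_def by (intro finite_PiE) auto
  have DB: "DB = kB ^ kA" unfolding DB_def T_def by (simp add: card_PiE)
  obtain h where h: "bij_betw h {..<DB} T"
    using ex_bij_betw_nat_finite[OF finT] unfolding DB_def atLeast0LessThan by blast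
  define L :: "nat + nat \<Rightarrow> nat set" where
    "L v = (case v of Inl i \<Rightarrow> (\<lambda>j. j * kB + h i j) ` {..<kA}
                    | Inr j \<Rightarrow> (\<lambda>x. j * kB + x) ` {..<kB})" for v
  have hlt: "h i j < kB" if "i < DB" "j < kA" for i j
    using that h unfolding bij_betw_def T_def by blast
  have eqD: "j = j'" if "j * kB + x = j' * kB + x'" "x < kB" "x' < kB" for j j' x x'
  proof -
    have "(j * kB + x) div kB = j" "(j' * kB + x') div kB = j'"
      using that(2,3) by simp_all
    then show ?thesis using that(1) by metis
  qed
  have "L v \<in> nsets UNIV kA" if v: "v \<in> left_part DB" for v
  proof -
    obtain i where i: "v = Inl i" "i < DB" using v by (auto simp: left_part_def)
    have "inj_on (\<lambda>j. j * kB + h i j) {..<kA}"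
      using eqD hlt[OF i(2)] unfolding inj_on_def by blast
    then show ?thesis using i by (simp add: L_def nsets_def card_image)
  qed
  moreover have "L v \<in> nsets UNIV kB" if "v \<in> right_part DA" for v
    using that by (auto simp: right_part_def L_def nsets_def card_image inj_on_def)
  moreover have False
    if c: "\<forall>v\<in>pverts (complete_bipartite DB DA). c v \<in> L v"
      "\<forall>(v, v')\<in>parcs (complete_bipartite DB DA). c v \<noteq> c v'" for c
  proof -
    have "\<exists>x<kB. c (Inr j) = j * kB + x" if "j < kA" for j
    proof -
      have "c (Inr j) \<in> L (Inr j)"
        using c(1) that assms by (auto simp: complete_bipartite_def right_part_def)
      then show ?thesis by (auto simp: L_def)
    qed
    then obtain f where f: "\<And>j. j < kA \<Longrightarrow> f j < kB \<and> c (Inr j) = j * kB + f j"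
      by metis
    have "restrict f {..<kA} \<in> T" using f by (auto simp: T_def)
    then obtain i where i: "i < DB" "h i = restrict f {..<kA}"
      using h unfolding bij_betw_def by (metis imageE lessThan_iff)
    have "c (Inl i) \<in> L (Inl i)"
      using c(1) i by (auto simp: complete_bipartite_def left_part_def)
    then obtain j where j: "j < kA" "c (Inl i) = j * kB + h i j"
      by (auto simp: L_def)
    then have "c (Inl i) = c (Inr j)" using i f by simp
    moreover have "(Inl i, Inr j) \<in> parcs (complete_bipartite DB DA)"
      using i j assms by (simp add: complete_bipartite_def left_part_def right_part_def)
    ultimately show False using c(2) by blast
  qed
  ultimately have "\<not> K_choosable DB DA kA kB"
    unfolding K_choosable_def choosable_def by blast
  moreover have "DB > 0" using DB assms by simp
  ultimately show ?thesis by blast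
qed

end

theory Submission
  imports Defs "HOL-Real_Asymp.Real_Asymp"
begin

text \<open>
  Colouring \<open>K\<close> fails iff every set of colours meeting all \<open>n\<close> lists of size \<open>m\<close> contains one of
  the \<open>D\<close> lists of size \<open>k\<close>. Replacing each colour by \<open>t\<close> copies turns \<open>(n, D, m)\<close> into
  \<open>(n, D t\<^sup>k, t m)\<close>, so \<open>\<beta>(m) / m\<^sup>k\<close> converges to its infimum \<open>c(n)\<close>. Combining \<open>r\<close> disjoint
  copies turns \<open>(n, D, m)\<close> into \<open>(n\<^sup>r, r D, r m)\<close>, so \<open>c(n\<^sup>r) r\<^sup>k\<^sup>-\<^sup>1 \<le> c(n)\<close>; as \<open>c\<close> is decreasing,
  \<open>c(n) (ln n)\<^sup>k\<^sup>-\<^sup>1\<close> converges to its infimum \<open>\<xi>\<^sub>m\<close>. Finally \<open>\<xi>\<^sub>m > 0\<close>: if \<open>D\<close> is small, a greedy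
  choice of colours meets all long lists while the potential \<open>\<Sum>\<^sub>i q ^ card (E\<^sub>i - I)\<close> at most
  doubles, which keeps the number of colours that would complete a short list below \<open>m / 2\<close>.
\<close>

section \<open>Non-choosability as a covering problem\<close>

text \<open>The lists form indexed families, so repetitions are allowed. \<open>T\<close> stands for
  the colours used on the side of the long lists; a vertex with list \<open>E i\<close> is blocked
  exactly when \<open>E i\<close> lies inside \<open>T\<close>.\<close>

definition obstruction :: "nat \<Rightarrow> nat \<Rightarrow> nat \<Rightarrow> nat \<Rightarrow> bool" where
  "obstruction k n D m \<longleftrightarrow>
     (\<exists>(E :: nat \<Rightarrow> nat set) S.
        (\<forall>i<D. finite (E i) \<and> card (E i) = k) \<and> (\<forall>j<n. finite (S j) \<and> card (S j) = m) \<and>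
        (\<forall>T. (\<forall>j<n. S j \<inter> T \<noteq> {}) \<longrightarrow> (\<exists>i<D. E i \<subseteq> T)))"

text \<open>In a complete bipartite graph a colouring is proper iff the two sides use disjoint sets
  of colours. If \<open>T\<close> meets every long list but contains no short one, colour one side
  inside \<open>T\<close> and the other outside; conversely, \<open>T\<close> is the set of colours
  given to the long lists.\<close>

lemma not_K_choosable_iff: "\<not> K_choosable D n k m \<longleftrightarrow> obstruction k n D m"
proof
  assume "\<not> K_choosable D n k m"
  then obtain C and L :: "nat + nat \<Rightarrow> nat set"
    where A: "\<forall>v\<in>left_part D. L v \<in> nsets C k" and B: "\<forall>v\<in>right_part n. L v \<in> nsets C m"
      and no: "\<nexists>c. (\<forall>v\<in>pverts (complete_bipartite D n). c v \<in> L v) \<and>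
                (\<forall>(v, v')\<in>parcs (complete_bipartite D n). c v \<noteq> c v')"
    unfolding K_choosable_def choosable_def by blast
  have "\<exists>i<D. L (Inl i) \<subseteq> T" if T: "\<forall>j<n. L (Inr j) \<inter> T \<noteq> {}" for T
  proof (rule ccontr)
    assume "\<not> ?thesis"
    then have "\<forall>i<D. \<exists>x. x \<in> L (Inl i) - T" by blast
    then obtain a where a: "\<forall>i<D. a i \<in> L (Inl i) - T" by metis
    have "\<forall>j<n. \<exists>x. x \<in> L (Inr j) \<inter> T" using T by blast
    then obtain b where b: "\<forall>j<n. b j \<in> L (Inr j) \<inter> T" by metis
    have ne: "a i \<noteq> b j" if "i < D" "j < n" for i j
      using a b that by (metis DiffD2 IntD2)
    show False
      using no[unfolded not_ex, rule_format, of "case_sum a b"] a b ne ne[symmetric]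
      by (auto simp: complete_bipartite_def left_part_def right_part_def)
  qed
  then show "obstruction k n D m"
    unfolding obstruction_def using A B
    by (intro exI[of _ "\<lambda>i. L (Inl i)"] exI[of _ "\<lambda>j. L (Inr j)"])
       (auto simp: left_part_def right_part_def nsets_def)
next
  assume "obstruction k n D m"
  then obtain E S :: "nat \<Rightarrow> nat set"
    where E: "\<forall>i<D. finite (E i) \<and> card (E i) = k"
      and S: "\<forall>j<n. finite (S j) \<and> card (S j) = m"
      and hit: "\<And>T. (\<forall>j<n. S j \<inter> T \<noteq> {}) \<Longrightarrow> \<exists>i<D. E i \<subseteq> T"
    unfolding obstruction_def by blast
  show "\<not> K_choosable D n k m"
  proof
    assume "K_choosable D n k m"
    moreover have "\<forall>v\<in>left_part D. case_sum E S v \<in> nsets UNIV k"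
      "\<forall>v\<in>right_part n. case_sum E S v \<in> nsets UNIV m"
      using E S by (auto simp: left_part_def right_part_def nsets_def)
    ultimately obtain c
      where c: "\<forall>v\<in>pverts (complete_bipartite D n). c v \<in> case_sum E S v"
        "\<forall>(v, v')\<in>parcs (complete_bipartite D n). c v \<noteq> c v'"
      unfolding K_choosable_def choosable_def by blast
    have "c (Inr j) \<in> S j" if "j < n" for j
      using c(1)[rule_format, of "Inr j"] that
      by (simp add: complete_bipartite_def right_part_def)
    then have "\<forall>j<n. S j \<inter> (\<lambda>j. c (Inr j)) ` {..<n} \<noteq> {}" by blast
    then obtain i where i: "i < D" "E i \<subseteq> (\<lambda>j. c (Inr j)) ` {..<n}" using hit by blast
    have "c (Inl i) \<in> E i"
      using c(1)[rule_format, of "Inl i"] i(1)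
      by (simp add: complete_bipartite_def left_part_def)
    then obtain j where "j < n" "c (Inl i) = c (Inr j)" using i(2) by blast
    then show False
      using c(2) i(1) by (auto simp: complete_bipartite_def left_part_def right_part_def)
  qed
qed

text \<open>Arbitrary finite index sets and countable colour types let the constructions below use
  pairs as colours and functions as indices; \<open>to_nat\<close> and enumerations carry everything
  back to natural numbers.\<close>

lemma obstructionI:
  fixes E :: "'i \<Rightarrow> 'c::countable set" and S :: "'j \<Rightarrow> 'c set"
  assumes I: "finite I" "card I = D" and J: "finite J" "card J = n"
    and E: "\<And>i. i \<in> I \<Longrightarrow> finite (E i) \<and> card (E i) = k"
    and S: "\<And>j. j \<in> J \<Longrightarrow> finite (S j) \<and> card (S j) = m"
    and hit: "\<And>T. (\<And>j. j \<in> J \<Longrightarrow> S j \<inter> T \<noteq> {}) \<Longrightarrow> \<exists>i\<in>I. E i \<subseteq> T"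
  shows "obstruction k n D m"
proof -
  obtain f where f: "bij_betw f {..<D} I"
    using ex_bij_betw_nat_finite[OF I(1)] I(2) by (auto simp: atLeast0LessThan)
  obtain g where g: "bij_betw g {..<n} J"
    using ex_bij_betw_nat_finite[OF J(1)] J(2) by (auto simp: atLeast0LessThan)
  have f': "f i \<in> I" if "i < D" for i using f that by (auto simp: bij_betw_def)
  have g': "g j \<in> J" if "j < n" for j using g that by (auto simp: bij_betw_def)
  have card: "card (to_nat ` X) = card X" for X :: "'c set"
    by (simp add: card_image)
  have "\<exists>i<D. to_nat ` E (f i) \<subseteq> T" if T: "\<forall>j<n. to_nat ` S (g j) \<inter> T \<noteq> {}" for T :: "nat set"
  proof -
    have "S j \<inter> to_nat -` T \<noteq> {}" if j: "j \<in> J" for j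
    proof -
      obtain j' where "j' < n" "j = g j'" using g j unfolding bij_betw_def by blast
      then show ?thesis using T by fastforce
    qed
    from hit[OF this] obtain i where "i \<in> I" "E i \<subseteq> to_nat -` T" by blast
    moreover obtain i' where "i' < D" "i = f i'"
      using f \<open>i \<in> I\<close> unfolding bij_betw_def by blast
    ultimately show ?thesis by blast
  qed
  then show ?thesis
    unfolding obstruction_def using E[OF f'] S[OF g']
    by (intro exI[of _ "\<lambda>i. to_nat ` E (f i)"] exI[of _ "\<lambda>j. to_nat ` S (g j)"])
       (auto simp: card)
qed

lemma obstructionE:
  assumes "obstruction k n D m"
  obtains E S :: "nat \<Rightarrow> nat set"
  where "\<And>i. i < D \<Longrightarrow> finite (E i)" "\<And>i. i < D \<Longrightarrow> card (E i) = k"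
    "\<And>j. j < n \<Longrightarrow> finite (S j)" "\<And>j. j < n \<Longrightarrow> card (S j) = m"
    "\<And>T. (\<And>j. j < n \<Longrightarrow> S j \<inter> T \<noteq> {}) \<Longrightarrow> \<exists>i<D. E i \<subseteq> T"
  using assms unfolding obstruction_def by blast

text \<open>One colour from each long list gives a set of at most \<open>n\<close> colours that
  meets all of them and so contains a set of size \<open>k\<close>.\<close>

lemma obstruction_imp_le:
  assumes "obstruction k n D m" "m > 0"
  shows "k \<le> n"
  using assms(1)
proof (rule obstructionE)
  fix E S :: "nat \<Rightarrow> nat set"
  assume E: "\<And>i. i < D \<Longrightarrow> card (E i) = k" and S: "\<And>j. j < n \<Longrightarrow> card (S j) = m"
    and hit: "\<And>T. (\<And>j. j < n \<Longrightarrow> S j \<inter> T \<noteq> {}) \<Longrightarrow> \<exists>i<D. E i \<subseteq> T"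
  have "\<forall>j<n. \<exists>x. x \<in> S j" using S assms(2) by (metis all_not_in_conv card.empty less_irrefl)
  then obtain b where b: "\<forall>j<n. b j \<in> S j" by metis
  obtain i where "i < D" "E i \<subseteq> b ` {..<n}"
    using hit[of "b ` {..<n}"] b by blast
  then show "k \<le> n"
    using E surj_card_le[of "{..<n}" "E i" b] by simp
qed

text \<open>The added lists repeat \<open>S 0\<close>, which exists because
  \<open>n > 0\<close>.\<close>

lemma obstruction_mono_lists:
  assumes "obstruction k n D m" "n > 0" "n \<le> n'"
  shows "obstruction k n' D m"
  using assms(1)
proof (rule obstructionE)
  fix E S :: "nat \<Rightarrow> nat set"
  assume *: "\<And>i. i < D \<Longrightarrow> finite (E i)" "\<And>i. i < D \<Longrightarrow> card (E i) = k"
    "\<And>j. j < n \<Longrightarrow> finite (S j)" "\<And>j. j < n \<Longrightarrow> card (S j) = m"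
    and hit: "\<And>T. (\<And>j. j < n \<Longrightarrow> S j \<inter> T \<noteq> {}) \<Longrightarrow> \<exists>i<D. E i \<subseteq> T"
  show ?thesis
  proof (rule obstructionI[of "{..<D}" D "{..<n'}" n' E k "\<lambda>j. if j < n then S j else S 0"])
    fix T assume T: "\<And>j. j \<in> {..<n'} \<Longrightarrow> (if j < n then S j else S 0) \<inter> T \<noteq> {}"
    have "S j \<inter> T \<noteq> {}" if "j < n" for j using T[of j] that assms(3) by simp
    then show "\<exists>i\<in>{..<D}. E i \<subseteq> T" using hit by blast
  qed (use * assms(2) in auto)
qed

lemma obstruction_antimono_size:
  assumes "obstruction k n D m'" "m \<le> m'"
  shows "obstruction k n D m"
  using assms(1)
proof (rule obstructionE)
  fix E S :: "nat \<Rightarrow> nat set"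
  assume *: "\<And>i. i < D \<Longrightarrow> finite (E i)" "\<And>i. i < D \<Longrightarrow> card (E i) = k"
    "\<And>j. j < n \<Longrightarrow> finite (S j)" "\<And>j. j < n \<Longrightarrow> card (S j) = m'"
    and hit: "\<And>T. (\<And>j. j < n \<Longrightarrow> S j \<inter> T \<noteq> {}) \<Longrightarrow> \<exists>i<D. E i \<subseteq> T"
  have "\<forall>j<n. \<exists>R. R \<subseteq> S j \<and> finite R \<and> card R = m"
    using *(3,4) assms(2) by (metis obtain_subset_with_card_n)
  then obtain R where R: "\<And>j. j < n \<Longrightarrow> R j \<subseteq> S j \<and> finite (R j) \<and> card (R j) = m" by metis
  show ?thesis
  proof (rule obstructionI[of "{..<D}" D "{..<n}" n E k R])
    fix T assume T: "\<And>j. j \<in> {..<n} \<Longrightarrow> R j \<inter> T \<noteq> {}"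
    have "S j \<inter> T \<noteq> {}" if "j < n" for j using T[of j] R[of j] that by blast
    then show "\<exists>i\<in>{..<D}. E i \<subseteq> T" using hit by blast
  qed (use * R in auto)
qed

section \<open>Blow-ups and products\<close>

text \<open>Each long list takes all \<open>t\<close> copies of its colours; each short list splits
  into \<open>t ^ k\<close> lists, one per choice of a copy of each colour. A short list inside the
  set of colours having a copy in \<open>T\<close> therefore lifts to one inside
  \<open>T\<close>.\<close>

lemma obstruction_blow_up:
  assumes "obstruction k n D m"
  shows "obstruction k n (D * t ^ k) (t * m)"
  using assms
proof (rule obstructionE)
  fix E S :: "nat \<Rightarrow> nat set"
  assume *: "\<And>i. i < D \<Longrightarrow> finite (E i)" "\<And>i. i < D \<Longrightarrow> card (E i) = k"
    "\<And>j. j < n \<Longrightarrow> finite (S j)" "\<And>j. j < n \<Longrightarrow> card (S j) = m"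
    and hit: "\<And>T. (\<And>j. j < n \<Longrightarrow> S j \<inter> T \<noteq> {}) \<Longrightarrow> \<exists>i<D. E i \<subseteq> T"
  define F where "F = (SIGMA d:{..<D}. PiE (E d) (\<lambda>_. {..<t}))"
  have fin: "finite (PiE (E d) (\<lambda>_. {..<t}))" if "d < D" for d
    using *(1)[OF that] by (intro finite_PiE) auto
  show ?thesis
  proof (rule obstructionI[of F "D * t ^ k" "{..<n}" n "\<lambda>(d, h). (\<lambda>x. (x, h x)) ` E d" k
        "\<lambda>j. S j \<times> {..<t}"])
    show "finite F" unfolding F_def using fin by auto
    have "card F = (\<Sum>d<D. card (PiE (E d) (\<lambda>_. {..<t})))"
      unfolding F_def using fin by simp
    also have "\<dots> = D * t ^ k" using *(1,2) by (simp add: card_PiE)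
    finally show "card F = D * t ^ k" .
  next
    fix i assume "i \<in> F"
    then show "finite (case i of (d, h) \<Rightarrow> (\<lambda>x. (x, h x)) ` E d) \<and>
        card (case i of (d, h) \<Rightarrow> (\<lambda>x. (x, h x)) ` E d) = k"
      using * by (auto simp: F_def card_image inj_on_def)
  next
    fix T assume T: "\<And>j. j \<in> {..<n} \<Longrightarrow> S j \<times> {..<t} \<inter> T \<noteq> {}"
    have "S j \<inter> {x. \<exists>y<t. (x, y) \<in> T} \<noteq> {}" if "j < n" for j
      using T[of j] that by blast
    from hit[OF this] obtain d where d: "d < D" "E d \<subseteq> {x. \<exists>y<t. (x, y) \<in> T}" by blast
    then have "\<forall>x\<in>E d. \<exists>y. y < t \<and> (x, y) \<in> T" by blast
    then obtain h where h: "\<And>x. x \<in> E d \<Longrightarrow> h x < t \<and> (x, h x) \<in> T" by metis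
    have "(d, restrict h (E d)) \<in> F" using d h by (auto simp: F_def)
    moreover have "(\<lambda>x. (x, restrict h (E d) x)) ` E d \<subseteq> T" using h by auto
    ultimately show "\<exists>i\<in>F. (case i of (d, h) \<Rightarrow> (\<lambda>x. (x, h x)) ` E d) \<subseteq> T"
      by (intro bexI[of _ "(d, restrict h (E d))"]) simp_all
  qed (use * in \<open>auto simp: card_cartesian_product\<close>)
qed

text \<open>
  Take \<open>r\<close> disjoint copies and all unions of one list from each copy. A set meeting all these
  unions meets all lists of some copy, for otherwise the union of missed lists would be missed.
\<close>
lemma obstruction_power:
  assumes "obstruction k n D m"
  shows "obstruction k (n ^ r) (r * D) (r * m)"
  using assms
proof (rule obstructionE)
  fix E S :: "nat \<Rightarrow> nat set"
  assume *: "\<And>i. i < D \<Longrightarrow> finite (E i)" "\<And>i. i < D \<Longrightarrow> card (E i) = k"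
    "\<And>j. j < n \<Longrightarrow> finite (S j)" "\<And>j. j < n \<Longrightarrow> card (S j) = m"
    and hit: "\<And>T. (\<And>j. j < n \<Longrightarrow> S j \<inter> T \<noteq> {}) \<Longrightarrow> \<exists>i<D. E i \<subseteq> T"
  define J where "J = PiE {..<r} (\<lambda>_. {..<n})"
  show ?thesis
  proof (rule obstructionI[of "{..<r} \<times> {..<D}" "r * D" J "n ^ r" "\<lambda>(a, d). {a} \<times> E d" k
        "\<lambda>f. SIGMA a:{..<r}. S (f a)"])
    show "finite J" unfolding J_def by (intro finite_PiE) auto
    show "card J = n ^ r" unfolding J_def by (simp add: card_PiE)
  next
    fix f assume "f \<in> J"
    then have f: "f a < n" if "a < r" for a using that by (auto simp: J_def)
    then show "finite (SIGMA a:{..<r}. S (f a)) \<and> card (SIGMA a:{..<r}. S (f a)) = r * m"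
      using * by auto
  next
    fix T assume T: "\<And>f. f \<in> J \<Longrightarrow> (SIGMA a:{..<r}. S (f a)) \<inter> T \<noteq> {}"
    have "\<exists>a<r. \<forall>j<n. S j \<inter> Pair a -` T \<noteq> {}"
    proof (rule ccontr)
      assume "\<not> ?thesis"
      then have "\<forall>a<r. \<exists>j. j < n \<and> S j \<inter> Pair a -` T = {}" by blast
      then obtain f where f: "\<And>a. a < r \<Longrightarrow> f a < n \<and> S (f a) \<inter> Pair a -` T = {}" by metis
      have "restrict f {..<r} \<in> J" using f by (auto simp: J_def)
      from T[OF this] obtain a x where "a < r" "x \<in> S (f a)" "(a, x) \<in> T" by auto
      then show False using f by blast
    qed
    then obtain a where a: "a < r" "\<And>j. j < n \<Longrightarrow> S j \<inter> Pair a -` T \<noteq> {}" by blast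
    from hit[OF a(2)] obtain d where "d < D" "E d \<subseteq> Pair a -` T" by blast
    then show "\<exists>i\<in>{..<r} \<times> {..<D}. (case i of (a, d) \<Rightarrow> {a} \<times> E d) \<subseteq> T"
      using a(1) by (intro bexI[of _ "(a, d)"]) auto
  qed (use * in \<open>auto simp: card_cartesian_product\<close>)
qed

section \<open>A greedy lower bound\<close>

text \<open>For \<open>q\<close> between 0 and 1 this is the expected number of short lists inside a
  random set that contains \<open>I\<close> and takes every other colour independently with
  probability \<open>q\<close>.\<close>

definition weight :: "real \<Rightarrow> (nat \<Rightarrow> 'c set) \<Rightarrow> nat \<Rightarrow> 'c set \<Rightarrow> real" where
  "weight q E D I = (\<Sum>i<D. q ^ card (E i - I))"

definition unhit :: "(nat \<Rightarrow> 'c set) \<Rightarrow> nat \<Rightarrow> 'c set \<Rightarrow> nat set" where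
  "unhit S n I = {j. j < n \<and> S j \<inter> I = {}}"

lemma finite_unhit [simp]: "finite (unhit S n I)"
  by (simp add: unhit_def)

text \<open>
  Averaging over the available colours yields one whose number of newly hit lists is large compared
  with the weight of the short lists through it; \<open>w\<close> is the initial weight.
\<close>
lemma greedy_step:
  fixes E S :: "nat \<Rightarrow> 'c set"
  assumes E: "\<And>i. i < D \<Longrightarrow> finite (E i)" "\<And>i. i < D \<Longrightarrow> card (E i) = k"
    and S: "\<And>j. j < n \<Longrightarrow> finite (S j)" "\<And>j. j < n \<Longrightarrow> card (S j) = m"
    and pos: "q > 0" "w > 0" "m > 0" "k > 0"
    and w: "4 * w \<le> q * m" and q: "q * m = 4 * k * L"
    and indep: "\<And>i. i < D \<Longrightarrow> \<not> E i \<subseteq> I"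
    and ne: "unhit S n I \<noteq> {}" and weight: "weight q E D I \<le> 2 * w"
  obtains v where "\<And>i. i < D \<Longrightarrow> \<not> E i \<subseteq> insert v I"
    and "card (unhit S n (insert v I)) < card (unhit S n I)"
    and "card (unhit S n (insert v I)) \<le>
           card (unhit S n I) * exp (- (L * (weight q E D (insert v I) - weight q E D I) / w))"
proof -
  define U where "U = unhit S n I"
  define Z where "Z = {i. i < D \<and> card (E i - I) = 1}"
  define forb where "forb = {v. \<exists>i<D. E i - I = {v}}"
  define V where "V = (\<Union>j\<in>U. S j) - forb"
  define cover where "cover v = card {j \<in> U. v \<in> S j}" for v
  define W where "W v = (\<Sum>i<D. if v \<in> E i then q ^ card (E i - I) else 0)" for v
  have [simp]: "finite U" by (simp add: U_def)
  have Upos: "card U > 0" using ne by (simp add: U_def card_gt_0_iff)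
  have Un: "j < n" "S j \<inter> I = {}" if "j \<in> U" for j using that by (auto simp: U_def unhit_def)
  have finV: "finite V" unfolding V_def using S(1) Un by auto
  have VI: "v \<notin> I" if "v \<in> V" for v using that Un by (auto simp: V_def)

  \<comment> \<open>Every colour of \<open>forb\<close> is the last missing colour of some list
    indexed by \<open>Z\<close>, and each such list contributes exactly \<open>q\<close> to the
    weight, which is at most \<open>2 * w\<close>.\<close>
  have "forb \<subseteq> (\<lambda>i. the_elem (E i - I)) ` Z"
    by (force simp: forb_def Z_def image_iff)
  moreover have finZ: "finite Z" by (simp add: Z_def)
  ultimately have finforb: "finite forb" and "card forb \<le> card Z"
    using finite_subset surj_card_le by blast+
  then have "q * card forb \<le> q * card Z" using pos by simp
  also have "\<dots> = (\<Sum>i\<in>Z. q ^ card (E i - I))" by (simp add: Z_def)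
  also have "\<dots> \<le> weight q E D I" unfolding weight_def
    by (intro sum_mono2) (use pos in \<open>auto simp: Z_def\<close>)
  also have "\<dots> \<le> q * (m / 2)" using weight w by simp
  finally have forb: "card forb \<le> real m / 2" using pos by simp

  \<comment> \<open>Each unhit list keeps at least half of its colours, so counting pairs of an
    unhit list and an allowed colour in two ways bounds the total cover from below.\<close>
  have "card U * (real m / 2) = (\<Sum>j\<in>U. real m / 2)" by simp
  also have "\<dots> \<le> (\<Sum>j\<in>U. real (card {v \<in> V. v \<in> S j}))"
  proof (intro sum_mono)
    fix j assume j: "j \<in> U"
    have eq: "{v \<in> V. v \<in> S j} = S j - forb" using j by (auto simp: V_def)
    have "card (S j) - card forb \<le> card (S j - forb)"
      using diff_card_le_card_Diff[OF finforb] .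
    then show "real m / 2 \<le> real (card {v \<in> V. v \<in> S j})"
      unfolding eq S(2)[OF Un(1)[OF j]] using forb by linarith
  qed
  also have "\<dots> = (\<Sum>v\<in>V. real (cover v))"
    unfolding cover_def of_nat_sum[symmetric]
    using sum_multicount_gen[of U V "\<lambda>j v. v \<in> S j" cover] finV
    by (auto simp: cover_def)
  finally have sumcover: "card U * (real m / 2) \<le> (\<Sum>v\<in>V. real (cover v))" .
  moreover have "card U * (real m / 2) > 0" using Upos pos by simp
  ultimately have Vne: "V \<noteq> {}" by auto

  \<comment> \<open>A short list is counted once for each of its at most \<open>k\<close> colours in
    \<open>V\<close>.\<close>
  have "(\<Sum>v\<in>V. W v) = (\<Sum>i<D. \<Sum>v\<in>V. if v \<in> E i then q ^ card (E i - I) else 0)"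
    unfolding W_def by (rule sum.swap)
  also have "\<dots> = (\<Sum>i<D. card (V \<inter> E i) * q ^ card (E i - I))"
    using finV by (simp add: sum.If_cases)
  also have "\<dots> \<le> (\<Sum>i<D. k * q ^ card (E i - I))"
  proof (intro sum_mono mult_right_mono)
    fix i assume "i \<in> {..<D}"
    then have "card (V \<inter> E i) \<le> k" using E card_mono[of "E i" "V \<inter> E i"] by auto
    then show "real (card (V \<inter> E i)) \<le> real k" by simp
  qed (use pos in auto)
  also have "\<dots> = k * weight q E D I" by (simp add: weight_def sum_distrib_left)
  also have "\<dots> \<le> k * (2 * w)" using weight by (intro mult_left_mono) auto
  finally have sumW: "(\<Sum>v\<in>V. W v) \<le> k * (2 * w)" .

  \<comment> \<open>Some colour has a ratio of cover to weight at least that of the two totals; the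
    cross-multiplied form also covers \<open>W v = 0\<close>.\<close>
  have "\<exists>v\<in>V. cover v * (k * (2 * w)) \<ge> card U * (real m / 2) * W v"
  proof (rule ccontr)
    assume "\<not> ?thesis"
    then have "(\<Sum>v\<in>V. cover v * (k * (2 * w))) < (\<Sum>v\<in>V. card U * (real m / 2) * W v)"
      using finV Vne by (intro sum_strict_mono) auto
    then have "(\<Sum>v\<in>V. real (cover v)) * (k * (2 * w)) < card U * (real m / 2) * (\<Sum>v\<in>V. W v)"
      by (simp add: sum_distrib_left sum_distrib_right)
    also have "\<dots> \<le> card U * (real m / 2) * (k * (2 * w))"
      using sumW by (intro mult_left_mono) auto
    also have "\<dots> \<le> (\<Sum>v\<in>V. real (cover v)) * (k * (2 * w))"
      using sumcover pos by (intro mult_right_mono) auto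
    finally show False by simp
  qed
  then obtain v where v: "v \<in> V" "cover v * (k * (2 * w)) \<ge> card U * (real m / 2) * W v" ..

  \<comment> \<open>Adding \<open>v\<close> divides the term of each list through \<open>v\<close>
    by \<open>q\<close> and changes no other term; the bound drops the subtracted old term.\<close>
  have "weight q E D (insert v I) - weight q E D I =
      (\<Sum>i<D. q ^ card (E i - insert v I) - q ^ card (E i - I))"
    by (simp add: weight_def sum_subtractf)
  also have "\<dots> \<le> (\<Sum>i<D. (if v \<in> E i then q ^ card (E i - I) else 0) / q)"
  proof (intro sum_mono)
    fix i assume i: "i \<in> {..<D}"
    show "q ^ card (E i - insert v I) - q ^ card (E i - I) \<le>
        (if v \<in> E i then q ^ card (E i - I) else 0) / q"
    proof (cases "v \<in> E i")
      case True
      have "E i - I = insert v (E i - insert v I)" using True VI[OF v(1)] by blast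
      moreover have "finite (E i - insert v I)" using E(1) i by simp
      ultimately have "card (E i - I) = Suc (card (E i - insert v I))"
        by (metis DiffD2 card_insert_disjoint insertI1)
      then show ?thesis using True pos by simp
    next
      case False
      then have "E i - insert v I = E i - I" by blast
      then show ?thesis using False by simp
    qed
  qed
  also have "\<dots> = W v / q" by (simp add: W_def sum_divide_distrib)
  finally have "q * (weight q E D (insert v I) - weight q E D I) \<le> W v"
    using pos by (simp add: field_simps)
  then have "card U * (real m / 2) * (q * (weight q E D (insert v I) - weight q E D I))
      \<le> cover v * (k * (2 * w))"
    using v(2) by (meson mult_left_mono order_trans of_nat_0_le_iff divide_nonneg_nonneg
        mult_nonneg_nonneg zero_le_numeral)
  \<comment> \<open>The value \<open>q * m = 4 * k * L\<close> is tuned for this: it splits off the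
    factor \<open>k * (2 * w)\<close> and leaves the exponent of the claim.\<close>
  also have "card U * (real m / 2) * (q * (weight q E D (insert v I) - weight q E D I)) =
      (k * (2 * w)) * (card U * (L * (weight q E D (insert v I) - weight q E D I) / w))"
  proof -
    have "card U * (real m / 2) * (q * (weight q E D (insert v I) - weight q E D I)) =
        card U * (q * m) / 2 * (weight q E D (insert v I) - weight q E D I)" by simp
    then show ?thesis unfolding q using pos by (simp add: mult_ac)
  qed
  finally have "(k * (2 * w)) * (card U * (L * (weight q E D (insert v I) - weight q E D I) / w))
      \<le> (k * (2 * w)) * cover v" by (simp add: mult.commute)
  then have gain: "card U * (L * (weight q E D (insert v I) - weight q E D I) / w) \<le> cover v"
    using pos by (subst (asm) mult_le_cancel_left_pos) auto

  have U': "unhit S n (insert v I) = U - {j \<in> U. v \<in> S j}"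
    by (auto simp: U_def unhit_def)
  then have "card (unhit S n (insert v I)) = card U - cover v"
    unfolding cover_def by (simp add: card_Diff_subset)
  moreover have "cover v \<le> card U" unfolding cover_def by (intro card_mono) auto
  ultimately have "card (unhit S n (insert v I)) = real (card U) - cover v" by simp
  also have "\<dots> \<le> card U * (1 + - (L * (weight q E D (insert v I) - weight q E D I) / w))"
    using gain by (simp add: algebra_simps)
  also have "\<dots> \<le> card U * exp (- (L * (weight q E D (insert v I) - weight q E D I) / w))"
    by (intro mult_left_mono exp_ge_add_one_self) auto
  finally have "card (unhit S n (insert v I)) \<le>
      card U * exp (- (L * (weight q E D (insert v I) - weight q E D I) / w))" .
  moreover have "unhit S n (insert v I) \<subset> U" unfolding U' using v(1) by (auto simp: V_def)
  then have "card (unhit S n (insert v I)) < card U" by (intro psubset_card_mono) auto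
  moreover have "\<not> E i \<subseteq> insert v I" if "i < D" for i
  proof
    assume "E i \<subseteq> insert v I"
    then have "E i - I = {v}" using indep[OF that] by blast
    then show False using v(1) that by (auto simp: V_def forb_def)
  qed
  ultimately show thesis using that unfolding U_def by blast
qed

text \<open>The potential, which is the number of unhit lists times
  \<open>exp (L * weight q E D I / w)\<close>, does not increase in \<open>greedy_step\<close>.
  While a list is unhit, the first factor is at least 1, so the weight is at most
  \<open>2 * w\<close>, as the next step requires.\<close>

lemma greedy_hitting_set:
  fixes E S :: "nat \<Rightarrow> 'c set"
  assumes E: "\<And>i. i < D \<Longrightarrow> finite (E i)" "\<And>i. i < D \<Longrightarrow> card (E i) = k"
    and S: "\<And>j. j < n \<Longrightarrow> finite (S j)" "\<And>j. j < n \<Longrightarrow> card (S j) = m"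
    and pos: "q > 0" "w > 0" "m > 0" "k > 0" "L > 0"
    and w: "4 * w \<le> q * m" and q: "q * m = 4 * k * L"
    and indep: "\<And>i. i < D \<Longrightarrow> \<not> E i \<subseteq> I"
    and potential: "card (unhit S n I) * exp (L * weight q E D I / w) \<le> exp (2 * L)"
  shows "\<exists>T. (\<forall>j<n. S j \<inter> T \<noteq> {}) \<and> (\<forall>i<D. \<not> E i \<subseteq> T)"
  using indep potential
proof (induction "card (unhit S n I)" arbitrary: I rule: less_induct)
  case less
  show ?case
  proof (cases "unhit S n I = {}")
    case True
    then have "\<forall>j<n. S j \<inter> I \<noteq> {}" by (auto simp: unhit_def)
    then show ?thesis using less.prems(1) by blast
  next
    case False
    then have "card (unhit S n I) \<ge> 1" by (simp add: Suc_le_eq card_gt_0_iff)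
    then have "exp (L * weight q E D I / w) \<le> card (unhit S n I) * exp (L * weight q E D I / w)"
      by simp
    also note less.prems(2)
    finally have "L * weight q E D I / w \<le> 2 * L" by simp
    then have "weight q E D I \<le> 2 * w" using pos by (simp add: field_simps)
    from greedy_step[OF E S pos(1-4) w q less.prems(1) False this]
    obtain v where v: "\<And>i. i < D \<Longrightarrow> \<not> E i \<subseteq> insert v I"
      "card (unhit S n (insert v I)) < card (unhit S n I)"
      "card (unhit S n (insert v I)) \<le>
        card (unhit S n I) * exp (- (L * (weight q E D (insert v I) - weight q E D I) / w))"
      by blast
    have "card (unhit S n (insert v I)) * exp (L * weight q E D (insert v I) / w) \<le>
        card (unhit S n I) * exp (- (L * (weight q E D (insert v I) - weight q E D I) / w)) *
          exp (L * weight q E D (insert v I) / w)"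
      using v(3) by (intro mult_right_mono) auto
    also have "\<dots> = card (unhit S n I) * exp (L * weight q E D I / w)"
      by (simp add: mult.assoc exp_add[symmetric] diff_divide_distrib right_diff_distrib)
    also note less.prems(2)
    finally show ?thesis using less.hyps v(1,2) by blast
  qed
qed

text \<open>The greedy choice starts at the empty set, where the weight is \<open>w\<close> and the
  potential \<open>n * exp L\<close> is at most \<open>exp (2 * L)\<close>. If the inequality
  failed, it would yield a set that meets all long lists and contains no short one.\<close>

lemma obstruction_lower_bound:
  assumes "obstruction k n D m" "k > 0" "m > 0" "D > 0" "L > 0" "n \<le> exp L"
  shows "real m ^ k < 4 * (4 * k * L) ^ (k - 1) * D"
proof (rule ccontr)
  assume "\<not> ?thesis"
  then have le: "4 * (4 * k * L) ^ (k - 1) * D \<le> real m ^ k" by simp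
  obtain E S :: "nat \<Rightarrow> nat set"
    where E: "\<And>i. i < D \<Longrightarrow> finite (E i)" "\<And>i. i < D \<Longrightarrow> card (E i) = k"
    and S: "\<And>j. j < n \<Longrightarrow> finite (S j)" "\<And>j. j < n \<Longrightarrow> card (S j) = m"
    and hit: "\<And>T. (\<And>j. j < n \<Longrightarrow> S j \<inter> T \<noteq> {}) \<Longrightarrow> \<exists>i<D. E i \<subseteq> T"
    using assms(1) by (rule obstructionE) blast
  \<comment> \<open>\<open>q\<close> is dictated by the equation \<open>q * m = 4 * k * L\<close> of
    the greedy step, and \<open>w\<close> is the weight of the empty set. After cancellation,
    \<open>4 * w \<le> q * m\<close> is the negated claim \<open>le\<close>.\<close>
  define q where "q = 4 * k * L / m"
  define w where "w = D * q ^ k"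
  have pos: "q > 0" "w > 0" using assms by (simp_all add: q_def w_def)
  have "4 * w \<le> q * m"
  proof -
    obtain l where k: "k = Suc l" using assms(2) gr0_conv_Suc by blast
    have qm: "q * m = 4 * k * L" using assms(3) by (simp add: q_def)
    have "4 * (q * m) ^ l * D \<le> real m ^ l * m" using le unfolding qm by (simp add: k mult.commute)
    then have "real m ^ l * (4 * q ^ l * D) \<le> real m ^ l * m"
      by (simp add: power_mult_distrib mult_ac)
    then have "4 * q ^ l * D \<le> m" using assms(3) by simp
    then have "q * (4 * q ^ l * D) \<le> q * m" using pos by (intro mult_left_mono) auto
    then show ?thesis by (simp add: w_def k mult_ac)
  qed
  moreover have "q * m = 4 * k * L" using assms(3) by (simp add: q_def)
  moreover have "\<not> E i \<subseteq> {}" if "i < D" for i using E(2)[OF that] assms(2) by auto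
  moreover have "card (unhit S n {}) * exp (L * weight q E D {} / w) \<le> exp (2 * L)"
  proof -
    have "unhit S n {} = {..<n}" by (auto simp: unhit_def)
    moreover have "weight q E D {} = w" using E(2) by (simp add: weight_def w_def)
    ultimately have "card (unhit S n {}) * exp (L * weight q E D {} / w) = n * exp L"
      using pos by simp
    also have "\<dots> \<le> exp L * exp L" using assms(6) by (intro mult_right_mono) auto
    finally show ?thesis by (simp add: exp_add[symmetric])
  qed
  ultimately have "\<exists>T. (\<forall>j<n. S j \<inter> T \<noteq> {}) \<and> (\<forall>i<D. \<not> E i \<subseteq> T)"
    by (intro greedy_hitting_set[OF E S pos assms(3,2,5)])
  then show False using hit by blast
qed

text \<open>The bound depends on \<open>k\<close> only, so the set defining \<open>xi_m\<close> is
  bounded below and its infimum is positive.\<close>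

lemma xi_lower_bound:
  assumes "obstruction k n D m" "k > 0" "m > 0" "D > 0"
  shows "1 / (4 * (4 * k) ^ (k - 1)) \<le> xi n D k m"
proof -
  have kn: "k \<le> n" using obstruction_imp_le assms by blast
  \<comment> \<open>For \<open>k = 1\<close> the value of \<open>L\<close> is irrelevant, but \<open>ln n\<close> may vanish.\<close>
  define L where "L = (if k = 1 then ln n + 1 else ln n)"
  have L: "L > 0" "ln n \<le> L" using kn assms(2) by (auto simp: L_def add_nonneg_pos)
  then have "n \<le> exp L" using kn assms(2) by (metis exp_ln exp_le_cancel_iff of_nat_0_less_iff less_le_trans)
  then have "real m ^ k \<le> 4 * (4 * k * L) ^ (k - 1) * D"
    using obstruction_lower_bound[OF assms L(1)] by simp
  \<comment> \<open>For \<open>k = 1\<close> the exponent is 0 and both sides are 1, so the extra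
    summand in \<open>L\<close> disappears.\<close>
  moreover have "(4 * k * L) ^ (k - 1) = (4 * k) ^ (k - 1) * ln n ^ (k - 1)"
    by (simp add: L_def power_mult_distrib)
  ultimately show ?thesis using assms by (simp add: xi_def field_simps)
qed

section \<open>The limit in the list size\<close>

context
  fixes k :: nat
  assumes k: "k > 0"
begin

lemma beta_obstruction:
  assumes "k \<le> n" "m > 0"
  shows "beta k n m > 0" "obstruction k n (beta k n m) m"
  using LeastI_ex[OF beta_exists[OF assms]] unfolding beta_def not_K_choosable_iff by auto

lemma beta_le: "obstruction k n D m \<Longrightarrow> D > 0 \<Longrightarrow> beta k n m \<le> D"
  unfolding beta_def not_K_choosable_iff by (intro Least_le) auto

text \<open>This is the constant \<open>c\<close> of the theorem. Defined as an infimum, it needs no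
  prior convergence proof and gives one half of the convergence at once.\<close>

definition limit_ratio :: "nat \<Rightarrow> real" where
  "limit_ratio n = (INF m\<in>{0<..}. beta k n m / real m ^ k)"

lemma limit_ratio_le: "m > 0 \<Longrightarrow> limit_ratio n \<le> beta k n m / real m ^ k"
  unfolding limit_ratio_def by (intro cINF_lower bdd_belowI[of _ 0]) auto

lemma limit_ratio_geI: "(\<And>m. m > 0 \<Longrightarrow> x \<le> beta k n m / real m ^ k) \<Longrightarrow> x \<le> limit_ratio n"
  unfolding limit_ratio_def by (intro cINF_greatest) auto

lemma limit_ratio_nonneg: "limit_ratio n \<ge> 0"
  by (intro limit_ratio_geI) auto

text \<open>Blow up by \<open>t\<close>, the floor of \<open>M / m\<close> plus 1, so that
  \<open>t * m\<close> is at least \<open>M\<close>; then shrink the long lists to size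
  \<open>M\<close>.\<close>

lemma beta_rescale:
  assumes n: "k \<le> n" and m: "m > 0"
  shows "beta k n M \<le> (real M / m + 1) ^ k * beta k n m"
proof -
  define t where "t = Suc (M div m)"
  have "M \<le> t * m" unfolding t_def using m
    by (metis dividend_less_div_times less_imp_le mult_Suc)
  then have "obstruction k n (beta k n m * t ^ k) M"
    using obstruction_antimono_size obstruction_blow_up beta_obstruction(2)[OF n m] by blast
  then have "beta k n M \<le> beta k n m * t ^ k"
    by (intro beta_le) (use beta_obstruction(1)[OF n m] in \<open>auto simp: t_def\<close>)
  then have "real (beta k n M) \<le> real (beta k n m * t ^ k)" by (rule of_nat_mono)
  also have "\<dots> = real t ^ k * beta k n m" by simp
  also have "\<dots> \<le> (real M / m + 1) ^ k * beta k n m"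
  proof (intro mult_right_mono power_mono)
    show "real t \<le> real M / m + 1" using of_nat_div_le_of_nat[of M m] by (simp add: t_def)
  qed auto
  finally show ?thesis .
qed

text \<open>As in Fekete's lemma, one \<open>m\<close> with ratio close to the infimum is rescaled
  to all large \<open>M\<close>; rounding costs only the term \<open>1 / M\<close>.\<close>

lemma tendsto_limit_ratio:
  assumes n: "k \<le> n"
  shows "(\<lambda>m. beta k n m / real m ^ k) \<longlonglongrightarrow> limit_ratio n"
proof (rule order_tendstoI)
  fix a assume a: "a < limit_ratio n"
  show "\<forall>\<^sub>F m in sequentially. a < beta k n m / real m ^ k"
    using eventually_gt_at_top[of 0] by eventually_elim (rule less_le_trans[OF a limit_ratio_le])
next
  fix a assume "limit_ratio n < a"
  then obtain m where m: "m > 0" "beta k n m / real m ^ k < a"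
    using limit_ratio_geI[of a n] by (meson not_le)
  have "(\<lambda>M. (1 / real m + 1 / real M) ^ k * beta k n m) \<longlonglongrightarrow> (1 / real m + 0) ^ k * beta k n m"
    by (intro tendsto_intros lim_1_over_n)
  then have "(\<lambda>M. (1 / real m + 1 / real M) ^ k * beta k n m) \<longlonglongrightarrow> beta k n m / real m ^ k"
    by (simp add: power_divide)
  from order_tendstoD(2)[OF this m(2)]
  show "\<forall>\<^sub>F M in sequentially. beta k n M / real M ^ k < a"
    using eventually_gt_at_top[of 0]
  proof eventually_elim
    case (elim M)
    have "beta k n M / real M ^ k \<le> ((real M / m + 1) ^ k * beta k n m) / real M ^ k"
      by (intro divide_right_mono beta_rescale n m) auto
    also have "\<dots> = ((real M / m + 1) / M) ^ k * beta k n m" by (simp add: power_divide)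
    also have "(real M / m + 1) / M = 1 / real m + 1 / real M" using elim by (simp add: field_simps)
    finally show ?case using elim by simp
  qed
qed

section \<open>The limit in the number of long lists\<close>

lemma limit_ratio_antimono:
  assumes "k \<le> n" "n \<le> n'"
  shows "limit_ratio n' \<le> limit_ratio n"
proof (rule limit_ratio_geI)
  fix m :: nat assume m: "m > 0"
  have "beta k n' m \<le> beta k n m"
    by (intro beta_le obstruction_mono_lists[OF beta_obstruction(2)] beta_obstruction(1))
      (use assms k m in auto)
  then have "beta k n' m / real m ^ k \<le> beta k n m / real m ^ k"
    by (intro divide_right_mono) auto
  then show "limit_ratio n' \<le> beta k n m / real m ^ k"
    using limit_ratio_le[OF m, of n'] by linarith
qed

text \<open>The power construction multiplies both the number of short lists and the size of the
  long ones by \<open>r\<close>, so the ratio is divided by \<open>r ^ (k - 1)\<close>.\<close>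

lemma limit_ratio_power:
  assumes n: "k \<le> n" and r: "r > 0"
  shows "limit_ratio (n ^ r) * real r ^ (k - 1) \<le> limit_ratio n"
proof (rule limit_ratio_geI)
  fix m :: nat assume m: "m > 0"
  have "beta k (n ^ r) (r * m) \<le> r * beta k n m"
    by (intro beta_le obstruction_power beta_obstruction(2))
      (use n r m beta_obstruction(1) in auto)
  then have "real (beta k (n ^ r) (r * m)) \<le> real (r * beta k n m)" by (rule of_nat_mono)
  then have "real (beta k (n ^ r) (r * m)) / real (r * m) ^ k \<le> real (r * beta k n m) / real (r * m) ^ k"
    by (intro divide_right_mono) auto
  then have "limit_ratio (n ^ r) \<le> real (r * beta k n m) / real (r * m) ^ k"
    using limit_ratio_le[of "r * m" "n ^ r"] r m by simp
  also have "real (r * m) ^ k = real r * real r ^ (k - 1) * real m ^ k"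
    using k by (simp add: power_mult_distrib power_Suc[symmetric] del: power_Suc)
  finally show "limit_ratio (n ^ r) * real r ^ (k - 1) \<le> beta k n m / real m ^ k"
    using r m by (simp add: field_simps)
qed

text \<open>A real \<open>Inf\<close> is a lower bound only for sets that are bounded below, which
  \<open>xi_lower_bound\<close> ensures.\<close>

lemma xi_m_le:
  assumes "obstruction k n D m" "D > 0" "m > 0"
  shows "xi_m k \<le> xi n D k m"
  unfolding xi_m_def
proof (rule cInf_lower)
  have "n > 0" using obstruction_imp_le[OF assms(1,3)] k by simp
  then show "xi n D k m \<in> {xi DA DB k kB | DA DB kB.
      DA > 0 \<and> DB > 0 \<and> kB > 0 \<and> \<not> K_choosable DB DA k kB}"
    using assms not_K_choosable_iff by blast
  show "bdd_below {xi DA DB k kB | DA DB kB.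
      DA > 0 \<and> DB > 0 \<and> kB > 0 \<and> \<not> K_choosable DB DA k kB}"
    using xi_lower_bound[OF _ k] by (intro bdd_belowI) (auto simp: not_K_choosable_iff)
qed

lemma xi_set_nonempty:
  "{xi DA DB k kB | DA DB kB. DA > 0 \<and> DB > 0 \<and> kB > 0 \<and> \<not> K_choosable DB DA k kB} \<noteq> {}"
  using beta_exists[of k k 1] k by auto

lemma xi_m_pos: "xi_m k > 0"
proof -
  have "1 / (4 * (4 * k) ^ (k - 1)) \<le> xi_m k"
    unfolding xi_m_def using xi_lower_bound[OF _ k]
    by (intro cInf_greatest[OF xi_set_nonempty]) (auto simp: not_K_choosable_iff)
  moreover have "0 < 1 / real (4 * (4 * k) ^ (k - 1))" using k by simp
  ultimately show ?thesis by linarith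
qed

text \<open>With \<open>n\<close> fixed and \<open>beta k n m\<close> short lists,
  \<open>xi_m k\<close> bounds the value of \<open>xi\<close> for every \<open>m > 0\<close>, hence
  also the limit in \<open>m\<close>.\<close>

lemma xi_m_le_limit_ratio:
  assumes n: "k \<le> n"
  shows "xi_m k \<le> limit_ratio n * ln n ^ (k - 1)"
proof -
  have "(\<lambda>m. beta k n m / real m ^ k * ln n ^ (k - 1)) \<longlonglongrightarrow> limit_ratio n * ln n ^ (k - 1)"
    by (intro tendsto_intros tendsto_limit_ratio n)
  moreover have "\<forall>\<^sub>F m in sequentially. xi_m k \<le> beta k n m / real m ^ k * ln n ^ (k - 1)"
    using eventually_gt_at_top[of 0]
  proof eventually_elim
    case (elim m)
    then show ?case using xi_m_le[OF beta_obstruction(2,1)[OF n elim] elim] by (simp add: xi_def)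
  qed
  ultimately show ?thesis by (rule tendsto_lowerbound) simp
qed

lemma limit_ratio_pos:
  assumes n: "k \<le> n"
  shows "limit_ratio n > 0"
proof -
  have "limit_ratio n \<noteq> 0" using xi_m_le_limit_ratio[OF n] xi_m_pos by auto
  then show ?thesis using limit_ratio_nonneg[of n] by simp
qed

text \<open>The conclusion includes \<open>2 \<le> n\<close> because \<open>tendsto_xi_m\<close>
  divides by \<open>ln n\<close>.\<close>

lemma limit_ratio_near_xi_m:
  assumes "xi_m k < a"
  obtains n where "k \<le> n" "2 \<le> n" "limit_ratio n * ln n ^ (k - 1) < a"
proof -
  obtain n D m where *: "D > 0" "m > 0" "obstruction k n D m" "xi n D k m < a"
    using cInf_lessD[OF xi_set_nonempty assms[unfolded xi_m_def]]
    unfolding not_K_choosable_iff by blast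
  have kn: "k \<le> n" using obstruction_imp_le * by blast
  have "real (beta k n m) \<le> real D" using beta_le * by simp
  then have "beta k n m / real m ^ k \<le> D / real m ^ k" by (intro divide_right_mono) auto
  then have "limit_ratio n \<le> D / real m ^ k" using limit_ratio_le[OF *(2), of n] by linarith
  then have "limit_ratio n * ln n ^ (k - 1) \<le> D / real m ^ k * ln n ^ (k - 1)"
    using kn k by (intro mult_right_mono) auto
  also have "\<dots> < a" using *(4) by (simp add: xi_def)
  finally have n: "limit_ratio n * ln n ^ (k - 1) < a" .
  show thesis
  proof (cases "2 \<le> n")
    case True
    then show ?thesis using that kn n by blast
  next
    case False
    then have "n = 1" "k = 1" using kn k by auto
    \<comment> \<open>The logarithm has exponent 0 here, so \<open>n\<close> can be raised to 2 by
      monotonicity.\<close>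
    then show ?thesis using that[of 2] n limit_ratio_antimono[of 1 2] by simp
  qed
qed

text \<open>For the upper bound, fix \<open>n\<close> with value below \<open>a\<close>. If
  \<open>n ^ r \<le> N\<close>, monotonicity and the power inequality bound
  \<open>limit_ratio N\<close> by \<open>limit_ratio n / r ^ (k - 1)\<close>; with \<open>r\<close>
  close to \<open>ln N / ln n\<close> the powers of \<open>ln N\<close> cancel in the limit.\<close>

lemma tendsto_xi_m: "(\<lambda>n. limit_ratio n * ln n ^ (k - 1)) \<longlonglongrightarrow> xi_m k"
proof (rule order_tendstoI)
  fix a assume a: "a < xi_m k"
  show "\<forall>\<^sub>F n in sequentially. a < limit_ratio n * ln n ^ (k - 1)"
    using eventually_ge_at_top[of k]
    by eventually_elim (rule less_le_trans[OF a xi_m_le_limit_ratio])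
next
  fix a assume "xi_m k < a"
  then obtain n where n: "k \<le> n" "2 \<le> n" "limit_ratio n * ln n ^ (k - 1) < a"
    by (rule limit_ratio_near_xi_m)
  have lnn: "ln n > 0" using n by simp
  have "(\<lambda>N. ln (real N) / (ln N / ln n - 1)) \<longlonglongrightarrow> ln n"
    using lnn by real_asymp
  then have "(\<lambda>N. limit_ratio n * (ln (real N) / (ln N / ln n - 1)) ^ (k - 1)) \<longlonglongrightarrow>
      limit_ratio n * ln n ^ (k - 1)"
    by (intro tendsto_intros)
  from order_tendstoD(2)[OF this n(3)]
  show "\<forall>\<^sub>F N in sequentially. limit_ratio N * ln N ^ (k - 1) < a"
    using eventually_gt_at_top[of n]
  proof eventually_elim
    case (elim N)
    \<comment> \<open>\<open>r\<close> is the largest exponent with \<open>n ^ r \<le> N\<close>.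
      Since \<open>N > n\<close>, \<open>x\<close> exceeds 1, so \<open>r\<close> is positive and
      \<open>x - 1\<close> may stand in a denominator.\<close>
    define x where "x = ln (real N) / ln n"
    define r where "r = nat \<lfloor>x\<rfloor>"
    have x: "x > 1" using elim(2) n lnn by (simp add: x_def)
    have r: "r > 0" "r \<le> x" "x - 1 < r" using x unfolding r_def by linarith+
    have "n ^ r \<le> N"
    proof -
      have "real n ^ r = exp (r * ln n)" using n by (simp add: exp_of_nat_mult)
      also have "\<dots> \<le> exp (x * ln n)" using r(2) lnn by simp
      also have "\<dots> = N" using elim(2) lnn by (simp add: x_def)
      finally show ?thesis by (simp flip: of_nat_power)
    qed
    moreover have "k \<le> n ^ r" using n(1) self_le_power[of n r] n(2) r(1) by linarith
    ultimately have "limit_ratio N * real r ^ (k - 1) \<le> limit_ratio (n ^ r) * real r ^ (k - 1)"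
      by (intro mult_right_mono limit_ratio_antimono) auto
    also have "\<dots> \<le> limit_ratio n" by (rule limit_ratio_power[OF n(1) r(1)])
    finally have "limit_ratio N * real r ^ (k - 1) \<le> limit_ratio n" .
    moreover have "limit_ratio N * (x - 1) ^ (k - 1) \<le> limit_ratio N * real r ^ (k - 1)"
      using r x by (intro mult_left_mono power_mono limit_ratio_nonneg) auto
    ultimately have "limit_ratio N * (x - 1) ^ (k - 1) \<le> limit_ratio n" by linarith
    then have "limit_ratio N \<le> limit_ratio n / (x - 1) ^ (k - 1)"
      using x by (simp add: field_simps)
    then have "limit_ratio N * ln N ^ (k - 1) \<le> limit_ratio n / (x - 1) ^ (k - 1) * ln N ^ (k - 1)"
      using elim(2) by (intro mult_right_mono) auto
    also have "\<dots> = limit_ratio n * (ln (real N) / (x - 1)) ^ (k - 1)"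
      by (simp add: power_divide)
    also have "\<dots> < a" using elim(1) by (simp add: x_def)
    finally show ?case .
  qed
qed

end

theorem theorem1p5:
  fixes kA :: nat
  assumes "kA > 0"
  shows "\<exists>c :: nat \<Rightarrow> real.
    (\<forall>DA\<ge>kA. (\<lambda>kB. real (beta kA DA kB)) \<sim>[at_top] (\<lambda>kB. c DA * real kB ^ kA)) \<and>
    c \<sim>[at_top] (\<lambda>DA. xi_m kA / ln (real DA) ^ (kA - 1))"
proof (intro exI conjI allI impI)
  \<comment> \<open>The witness left open by \<open>exI\<close> becomes
    \<open>limit_ratio kA\<close> through the \<open>show\<close> steps.\<close>
  fix DA assume DA: "kA \<le> DA"
  have "(\<lambda>kB. beta kA DA kB / real kB ^ kA / limit_ratio kA DA) \<longlonglongrightarrow>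
      limit_ratio kA DA / limit_ratio kA DA"
    using limit_ratio_pos[OF assms DA]
    by (intro tendsto_divide tendsto_limit_ratio[OF assms DA] tendsto_const) auto
  then show "(\<lambda>kB. real (beta kA DA kB)) \<sim>[at_top] (\<lambda>kB. limit_ratio kA DA * real kB ^ kA)"
    using limit_ratio_pos[OF assms DA] by (intro asymp_equivI') (simp add: mult.commute)
next
  have "(\<lambda>n. limit_ratio kA n * ln n ^ (kA - 1) / xi_m kA) \<longlonglongrightarrow> xi_m kA / xi_m kA"
    using xi_m_pos[OF assms] by (intro tendsto_divide tendsto_xi_m[OF assms] tendsto_const) auto
  then show "limit_ratio kA \<sim>[at_top] (\<lambda>DA. xi_m kA / ln (real DA) ^ (kA - 1))"
    using xi_m_pos[OF assms] by (intro asymp_equivI') simp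
qed

end
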